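(* Let $L$ be either of the sequent calculi $\mathrm{lTS4}$ or $\mathrm{gTS4}$ defined in the context. Then $L$ and $\mathrm{GS4}$ are theorem-equivalent, i.e. a sequent is provable in $L$ if and only if it is provable in $\mathrm{GS4}$.
   Context: Formulas are built from countably many propositional variables using the binary connectives $\wedge,\vee,\to$ and the unary connectives $\neg,\Box,\Diamond$. Letters $\Gamma,\Delta$ (possibly with subscripts) denote finite, possibly empty, sets of formulas; a sequent is an expression $\Gamma\Rightarrow\Delta$; a comma denotes union. For a word $w$ over $\{\neg,\Box,\Diamond\}$, $w\Gamma=\{w\gamma:\gamma\in\Gamma\}$. A rule "$S_1;\dots;S_n\,/\,S$" has premises $S_1,\dots,S_n$ and conclusion $S$. Provability includes the rule (cut) unless stated otherwise. The calculus lTS4. Initial sequents: for every propositional variable $p$: $p\Rightarrow p$, $\neg p\Rightarrow\neg p$, $\neg p,p\Rightarrow$, and $\Rightarrow\neg p,p$. Structural rules: (cut) $\Gamma\Rightarrow\alpha$; $\alpha,\Gamma\Rightarrow\Delta$ / $\Gamma\Rightarrow\Delta$. (we-left) $\Gamma\Rightarrow\Delta$ / $\alpha,\Gamma\Rightarrow\Delta$. (we-right) $\Gamma\Rightarrow\Delta$ / $\Gamma\Rightarrow\Delta,\alpha$. Non-twist logical rules: ($\wedge$left) $\alpha,\beta,\Gamma\Rightarrow\Delta$ / $\alpha\wedge\beta,\Gamma\Rightarrow\Delta$. ($\wedge$right) $\Gamma\Rightarrow\Delta,\alpha$; $\Gamma\Rightarrow\Delta,\beta$ / $\Gamma\Rightarrow\Delta,\alpha\wedge\beta$.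 ($\vee$left) $\alpha,\Gamma\Rightarrow\Delta$; $\beta,\Gamma\Rightarrow\Delta$ / $\alpha\vee\beta,\Gamma\Rightarrow\Delta$. ($\vee$right) $\Gamma\Rightarrow\Delta,\alpha,\beta$ / $\Gamma\Rightarrow\Delta,\alpha\vee\beta$. ($\to$left) $\Gamma\Rightarrow\Delta,\alpha$; $\beta,\Gamma\Rightarrow\Delta$ / $\alpha\to\beta,\Gamma\Rightarrow\Delta$. ($\to$right) $\alpha,\Gamma\Rightarrow\Delta,\beta$ / $\Gamma\Rightarrow\Delta,\alpha\to\beta$. ($\Box$left) $\alpha,\Gamma\Rightarrow\Delta$ / $\Box\alpha,\Gamma\Rightarrow\Delta$. ($\Box$right) $\Box\Gamma_1,\neg\Diamond\Gamma_2\Rightarrow\Diamond\Delta_1,\neg\Box\Delta_2,\alpha$ / $\Box\Gamma_1,\neg\Diamond\Gamma_2\Rightarrow\Diamond\Delta_1,\neg\Box\Delta_2,\Box\alpha$. ($\Diamond$left) $\alpha,\Box\Gamma_1,\neg\Diamond\Gamma_2\Rightarrow\Diamond\Delta_1,\neg\Box\Delta_2$ / $\Diamond\alpha,\Box\Gamma_1,\neg\Diamond\Gamma_2\Rightarrow\Diamond\Delta_1,\neg\Box\Delta_2$. ($\Diamond$right) $\Gamma\Rightarrow\Delta,\alpha$ / $\Gamma\Rightarrow\Delta,\Diamond\alpha$. Twist rules: ($\neg\neg$left$^t$) $\alpha,\Gamma\Rightarrow\Delta$ / $\neg\neg\alpha,\Gamma\Rightarrow\Delta$. ($\neg\neg$right$^t$)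 $\Gamma\Rightarrow\Delta,\alpha$ / $\Gamma\Rightarrow\Delta,\neg\neg\alpha$. ($\neg\wedge$left$^t$) $\Gamma\Rightarrow\Delta,\alpha$; $\Gamma\Rightarrow\Delta,\beta$ / $\neg(\alpha\wedge\beta),\Gamma\Rightarrow\Delta$. ($\neg\wedge$right$^t$) $\alpha,\beta,\Gamma\Rightarrow\Delta$ / $\Gamma\Rightarrow\Delta,\neg(\alpha\wedge\beta)$. ($\neg\vee$left$^t$) $\Gamma\Rightarrow\Delta,\alpha,\beta$ / $\neg(\alpha\vee\beta),\Gamma\Rightarrow\Delta$. ($\neg\vee$right$^t$) $\alpha,\Gamma\Rightarrow\Delta$; $\beta,\Gamma\Rightarrow\Delta$ / $\Gamma\Rightarrow\Delta,\neg(\alpha\vee\beta)$. ($\neg\to$left$^t$) $\alpha,\Gamma\Rightarrow\Delta,\beta$ / $\neg(\alpha\to\beta),\Gamma\Rightarrow\Delta$. ($\neg\to$right$^t$) $\Gamma\Rightarrow\Delta,\alpha$; $\beta,\Gamma\Rightarrow\Delta$ / $\Gamma\Rightarrow\Delta,\neg(\alpha\to\beta)$. ($\neg\Box$left$^t$) $\Box\Gamma_1,\neg\Diamond\Gamma_2\Rightarrow\Diamond\Delta_1,\neg\Box\Delta_2,\alpha$ / $\neg\Box\alpha,\Box\Gamma_1,\neg\Diamond\Gamma_2\Rightarrow\Diamond\Delta_1,\neg\Box\Delta_2$. ($\neg\Box$right$^t$) $\alpha,\Gamma\Rightarrow\Delta$ / $\Gamma\Rightarrow\Delta,\neg\Box\alpha$.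 ($\neg\Diamond$left$^t$) $\Gamma\Rightarrow\Delta,\alpha$ / $\neg\Diamond\alpha,\Gamma\Rightarrow\Delta$. ($\neg\Diamond$right$^t$) $\alpha,\Box\Gamma_1,\neg\Diamond\Gamma_2\Rightarrow\Diamond\Delta_1,\neg\Box\Delta_2$ / $\Box\Gamma_1,\neg\Diamond\Gamma_2\Rightarrow\Diamond\Delta_1,\neg\Box\Delta_2,\neg\Diamond\alpha$. The calculus gTS4 is obtained from lTS4 by replacing ($\Box$right), ($\Diamond$left), ($\neg\Box$left$^t$), ($\neg\Diamond$right$^t$) with: ($\Box$right$^T$) $\Box\Gamma_1,\Box\Delta_2\Rightarrow\Diamond\Delta_1,\Diamond\Gamma_2,\alpha$ / $\Box\Gamma_1,\neg\Diamond\Gamma_2\Rightarrow\Diamond\Delta_1,\neg\Box\Delta_2,\Box\alpha$. ($\Diamond$left$^T$) $\alpha,\Box\Gamma_1,\Box\Delta_2\Rightarrow\Diamond\Delta_1,\Diamond\Gamma_2$ / $\Diamond\alpha,\Box\Gamma_1,\neg\Diamond\Gamma_2\Rightarrow\Diamond\Delta_1,\neg\Box\Delta_2$. ($\neg\Box$left$^T$) $\Box\Gamma_1,\Box\Delta_2\Rightarrow\Diamond\Delta_1,\Diamond\Gamma_2,\alpha$ / $\neg\Box\alpha,\Box\Gamma_1,\neg\Diamond\Gamma_2\Rightarrow\Diamond\Delta_1,\neg\Box\Delta_2$. ($\neg\Diamond$right$^T$) $\alpha,\Box\Gamma_1,\Box\Delta_2\Rightarrow\Diamond\Delta_1,\Diamond\Gamma_2$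 / $\Box\Gamma_1,\neg\Diamond\Gamma_2\Rightarrow\Diamond\Delta_1,\neg\Box\Delta_2,\neg\Diamond\alpha$. (All other rules and initial sequents of lTS4, including ($\neg\Diamond$left$^t$), are kept.) The calculus GS4 (Kripke's calculus for S4): initial sequents $p\Rightarrow p$ for every propositional variable $p$; rules (cut), (we-left), (we-right), ($\wedge$left), ($\wedge$right), ($\vee$left), ($\vee$right), ($\to$left), ($\to$right), ($\Box$left), ($\Diamond$right) exactly as in lTS4, together with: ($\neg$left) $\Gamma\Rightarrow\Delta,\alpha$ / $\neg\alpha,\Gamma\Rightarrow\Delta$. ($\neg$right) $\alpha,\Gamma\Rightarrow\Delta$ / $\Gamma\Rightarrow\Delta,\neg\alpha$. ($\Box$right$^k$) $\Box\Gamma\Rightarrow\Diamond\Delta,\alpha$ / $\Box\Gamma\Rightarrow\Diamond\Delta,\Box\alpha$. ($\Diamond$left$^k$) $\alpha,\Box\Gamma\Rightarrow\Diamond\Delta$ / $\Diamond\alpha,\Box\Gamma\Rightarrow\Diamond\Delta$. GS4 has no twist rules and no other rules. *)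

theory Defs
  imports "HOL-Library.FSet"
begin

datatype form =
    Var nat
  | Conj form form  (infixr \<open>\<^bold>\<and>\<close> 130)
  | Disj form form  (infixr \<open>\<^bold>\<or>\<close> 120)
  | Imp form form   (infixr \<open>\<^bold>\<rightarrow>\<close> 110)
  | Neg form        (\<open>\<^bold>\<not> _\<close> [140] 140)
  | Box form        (\<open>\<^bold>\<box> _\<close> [140] 140)
  | Dia form        (\<open>\<^bold>\<diamond> _\<close> [140] 140)

datatype sequent = Sequent (antecedent: "form fset") (succedent: "form fset")  (infix \<open>\<Rrightarrow>\<close> 55)

text \<open>A calculus is the set of its rule instances, each a pair of the list of premises and the
  conclusion; an initial sequent is an instance without premises. Since a comma in a sequent denotes
  union, contexts are extended by \<^const>\<open>finsert\<close>, and the principal formula may already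
  belong to the context.\<close>

type_synonym calculus = "(sequent list \<times> sequent) set"

inductive provable :: "calculus \<Rightarrow> sequent \<Rightarrow> bool" for L :: calculus where
  "(Ss, S) \<in> L \<Longrightarrow> (\<And>S'. S' \<in> set Ss \<Longrightarrow> provable L S') \<Longrightarrow> provable L S"

definition boxes :: "form fset \<Rightarrow> form fset" where
  "boxes \<Gamma> = (\<lambda>\<gamma>. \<^bold>\<box> \<gamma>) |`| \<Gamma>"

definition dias :: "form fset \<Rightarrow> form fset" where
  "dias \<Gamma> = (\<lambda>\<gamma>. \<^bold>\<diamond> \<gamma>) |`| \<Gamma>"

definition neg_boxes :: "form fset \<Rightarrow> form fset" where
  "neg_boxes \<Gamma> = (\<lambda>\<gamma>. \<^bold>\<not> \<^bold>\<box> \<gamma>) |`| \<Gamma>"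

definition neg_dias :: "form fset \<Rightarrow> form fset" where
  "neg_dias \<Gamma> = (\<lambda>\<gamma>. \<^bold>\<not> \<^bold>\<diamond> \<gamma>) |`| \<Gamma>"

inductive_set common_rules :: calculus where
  init: "([], {|Var p|} \<Rrightarrow> {|Var p|}) \<in> common_rules"
| cut: "([\<Gamma> \<Rrightarrow> {|\<alpha>|}, finsert \<alpha> \<Gamma> \<Rrightarrow> \<Delta>], \<Gamma> \<Rrightarrow> \<Delta>) \<in> common_rules"
| we_left: "([\<Gamma> \<Rrightarrow> \<Delta>], finsert \<alpha> \<Gamma> \<Rrightarrow> \<Delta>) \<in> common_rules"
| we_right: "([\<Gamma> \<Rrightarrow> \<Delta>], \<Gamma> \<Rrightarrow> finsert \<alpha> \<Delta>) \<in> common_rules"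
| conj_left: "([finsert \<alpha> (finsert \<beta> \<Gamma>) \<Rrightarrow> \<Delta>], finsert (\<alpha> \<^bold>\<and> \<beta>) \<Gamma> \<Rrightarrow> \<Delta>) \<in> common_rules"
| conj_right: "([\<Gamma> \<Rrightarrow> finsert \<alpha> \<Delta>, \<Gamma> \<Rrightarrow> finsert \<beta> \<Delta>], \<Gamma> \<Rrightarrow> finsert (\<alpha> \<^bold>\<and> \<beta>) \<Delta>) \<in> common_rules"
| disj_left: "([finsert \<alpha> \<Gamma> \<Rrightarrow> \<Delta>, finsert \<beta> \<Gamma> \<Rrightarrow> \<Delta>], finsert (\<alpha> \<^bold>\<or> \<beta>) \<Gamma> \<Rrightarrow> \<Delta>) \<in> common_rules"
| disj_right: "([\<Gamma> \<Rrightarrow> finsert \<alpha> (finsert \<beta> \<Delta>)], \<Gamma> \<Rrightarrow> finsert (\<alpha> \<^bold>\<or> \<beta>) \<Delta>) \<in> common_rules"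
| imp_left: "([\<Gamma> \<Rrightarrow> finsert \<alpha> \<Delta>, finsert \<beta> \<Gamma> \<Rrightarrow> \<Delta>], finsert (\<alpha> \<^bold>\<rightarrow> \<beta>) \<Gamma> \<Rrightarrow> \<Delta>) \<in> common_rules"
| imp_right: "([finsert \<alpha> \<Gamma> \<Rrightarrow> finsert \<beta> \<Delta>], \<Gamma> \<Rrightarrow> finsert (\<alpha> \<^bold>\<rightarrow> \<beta>) \<Delta>) \<in> common_rules"
| box_left: "([finsert \<alpha> \<Gamma> \<Rrightarrow> \<Delta>], finsert (\<^bold>\<box> \<alpha>) \<Gamma> \<Rrightarrow> \<Delta>) \<in> common_rules"
| dia_right: "([\<Gamma> \<Rrightarrow> finsert \<alpha> \<Delta>], \<Gamma> \<Rrightarrow> finsert (\<^bold>\<diamond> \<alpha>) \<Delta>) \<in> common_rules"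

inductive_set twist_rules :: calculus where
  init_neg: "([], {|\<^bold>\<not> Var p|} \<Rrightarrow> {|\<^bold>\<not> Var p|}) \<in> twist_rules"
| init_left: "([], {|\<^bold>\<not> Var p, Var p|} \<Rrightarrow> {||}) \<in> twist_rules"
| init_right: "([], {||} \<Rrightarrow> {|\<^bold>\<not> Var p, Var p|}) \<in> twist_rules"
| neg_neg_left: "([finsert \<alpha> \<Gamma> \<Rrightarrow> \<Delta>], finsert (\<^bold>\<not> \<^bold>\<not> \<alpha>) \<Gamma> \<Rrightarrow> \<Delta>) \<in> twist_rules"
| neg_neg_right: "([\<Gamma> \<Rrightarrow> finsert \<alpha> \<Delta>], \<Gamma> \<Rrightarrow> finsert (\<^bold>\<not> \<^bold>\<not> \<alpha>) \<Delta>) \<in> twist_rules"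
| neg_conj_left: "([\<Gamma> \<Rrightarrow> finsert \<alpha> \<Delta>, \<Gamma> \<Rrightarrow> finsert \<beta> \<Delta>], finsert (\<^bold>\<not> (\<alpha> \<^bold>\<and> \<beta>)) \<Gamma> \<Rrightarrow> \<Delta>) \<in> twist_rules"
| neg_conj_right: "([finsert \<alpha> (finsert \<beta> \<Gamma>) \<Rrightarrow> \<Delta>], \<Gamma> \<Rrightarrow> finsert (\<^bold>\<not> (\<alpha> \<^bold>\<and> \<beta>)) \<Delta>) \<in> twist_rules"
| neg_disj_left: "([\<Gamma> \<Rrightarrow> finsert \<alpha> (finsert \<beta> \<Delta>)], finsert (\<^bold>\<not> (\<alpha> \<^bold>\<or> \<beta>)) \<Gamma> \<Rrightarrow> \<Delta>) \<in> twist_rules"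
| neg_disj_right: "([finsert \<alpha> \<Gamma> \<Rrightarrow> \<Delta>, finsert \<beta> \<Gamma> \<Rrightarrow> \<Delta>], \<Gamma> \<Rrightarrow> finsert (\<^bold>\<not> (\<alpha> \<^bold>\<or> \<beta>)) \<Delta>) \<in> twist_rules"
| neg_imp_left: "([finsert \<alpha> \<Gamma> \<Rrightarrow> finsert \<beta> \<Delta>], finsert (\<^bold>\<not> (\<alpha> \<^bold>\<rightarrow> \<beta>)) \<Gamma> \<Rrightarrow> \<Delta>) \<in> twist_rules"
| neg_imp_right: "([\<Gamma> \<Rrightarrow> finsert \<alpha> \<Delta>, finsert \<beta> \<Gamma> \<Rrightarrow> \<Delta>], \<Gamma> \<Rrightarrow> finsert (\<^bold>\<not> (\<alpha> \<^bold>\<rightarrow> \<beta>)) \<Delta>) \<in> twist_rules"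
| neg_box_right: "([finsert \<alpha> \<Gamma> \<Rrightarrow> \<Delta>], \<Gamma> \<Rrightarrow> finsert (\<^bold>\<not> \<^bold>\<box> \<alpha>) \<Delta>) \<in> twist_rules"
| neg_dia_left: "([\<Gamma> \<Rrightarrow> finsert \<alpha> \<Delta>], finsert (\<^bold>\<not> \<^bold>\<diamond> \<alpha>) \<Gamma> \<Rrightarrow> \<Delta>) \<in> twist_rules"

inductive_set local_rules :: calculus where
  box_right:
    "([boxes \<Gamma>\<^sub>1 |\<union>| neg_dias \<Gamma>\<^sub>2 \<Rrightarrow> finsert \<alpha> (dias \<Delta>\<^sub>1 |\<union>| neg_boxes \<Delta>\<^sub>2)],
      boxes \<Gamma>\<^sub>1 |\<union>| neg_dias \<Gamma>\<^sub>2 \<Rrightarrow> finsert (\<^bold>\<box> \<alpha>) (dias \<Delta>\<^sub>1 |\<union>| neg_boxes \<Delta>\<^sub>2)) \<in> local_rules"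
| dia_left:
    "([finsert \<alpha> (boxes \<Gamma>\<^sub>1 |\<union>| neg_dias \<Gamma>\<^sub>2) \<Rrightarrow> dias \<Delta>\<^sub>1 |\<union>| neg_boxes \<Delta>\<^sub>2],
      finsert (\<^bold>\<diamond> \<alpha>) (boxes \<Gamma>\<^sub>1 |\<union>| neg_dias \<Gamma>\<^sub>2) \<Rrightarrow> dias \<Delta>\<^sub>1 |\<union>| neg_boxes \<Delta>\<^sub>2) \<in> local_rules"
| neg_box_left:
    "([boxes \<Gamma>\<^sub>1 |\<union>| neg_dias \<Gamma>\<^sub>2 \<Rrightarrow> finsert \<alpha> (dias \<Delta>\<^sub>1 |\<union>| neg_boxes \<Delta>\<^sub>2)],
      finsert (\<^bold>\<not> \<^bold>\<box> \<alpha>) (boxes \<Gamma>\<^sub>1 |\<union>| neg_dias \<Gamma>\<^sub>2) \<Rrightarrow> dias \<Delta>\<^sub>1 |\<union>| neg_boxes \<Delta>\<^sub>2) \<in> local_rules"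
| neg_dia_right:
    "([finsert \<alpha> (boxes \<Gamma>\<^sub>1 |\<union>| neg_dias \<Gamma>\<^sub>2) \<Rrightarrow> dias \<Delta>\<^sub>1 |\<union>| neg_boxes \<Delta>\<^sub>2],
      boxes \<Gamma>\<^sub>1 |\<union>| neg_dias \<Gamma>\<^sub>2 \<Rrightarrow> finsert (\<^bold>\<not> \<^bold>\<diamond> \<alpha>) (dias \<Delta>\<^sub>1 |\<union>| neg_boxes \<Delta>\<^sub>2)) \<in> local_rules"

inductive_set global_rules :: calculus where
  box_right:
    "([boxes \<Gamma>\<^sub>1 |\<union>| boxes \<Delta>\<^sub>2 \<Rrightarrow> finsert \<alpha> (dias \<Delta>\<^sub>1 |\<union>| dias \<Gamma>\<^sub>2)],
      boxes \<Gamma>\<^sub>1 |\<union>| neg_dias \<Gamma>\<^sub>2 \<Rrightarrow> finsert (\<^bold>\<box> \<alpha>) (dias \<Delta>\<^sub>1 |\<union>| neg_boxes \<Delta>\<^sub>2)) \<in> global_rules"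
| dia_left:
    "([finsert \<alpha> (boxes \<Gamma>\<^sub>1 |\<union>| boxes \<Delta>\<^sub>2) \<Rrightarrow> dias \<Delta>\<^sub>1 |\<union>| dias \<Gamma>\<^sub>2],
      finsert (\<^bold>\<diamond> \<alpha>) (boxes \<Gamma>\<^sub>1 |\<union>| neg_dias \<Gamma>\<^sub>2) \<Rrightarrow> dias \<Delta>\<^sub>1 |\<union>| neg_boxes \<Delta>\<^sub>2) \<in> global_rules"
| neg_box_left:
    "([boxes \<Gamma>\<^sub>1 |\<union>| boxes \<Delta>\<^sub>2 \<Rrightarrow> finsert \<alpha> (dias \<Delta>\<^sub>1 |\<union>| dias \<Gamma>\<^sub>2)],
      finsert (\<^bold>\<not> \<^bold>\<box> \<alpha>) (boxes \<Gamma>\<^sub>1 |\<union>| neg_dias \<Gamma>\<^sub>2) \<Rrightarrow> dias \<Delta>\<^sub>1 |\<union>| neg_boxes \<Delta>\<^sub>2) \<in> global_rules"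
| neg_dia_right:
    "([finsert \<alpha> (boxes \<Gamma>\<^sub>1 |\<union>| boxes \<Delta>\<^sub>2) \<Rrightarrow> dias \<Delta>\<^sub>1 |\<union>| dias \<Gamma>\<^sub>2],
      boxes \<Gamma>\<^sub>1 |\<union>| neg_dias \<Gamma>\<^sub>2 \<Rrightarrow> finsert (\<^bold>\<not> \<^bold>\<diamond> \<alpha>) (dias \<Delta>\<^sub>1 |\<union>| neg_boxes \<Delta>\<^sub>2)) \<in> global_rules"

inductive_set kripke_rules :: calculus where
  neg_left: "([\<Gamma> \<Rrightarrow> finsert \<alpha> \<Delta>], finsert (\<^bold>\<not> \<alpha>) \<Gamma> \<Rrightarrow> \<Delta>) \<in> kripke_rules"
| neg_right: "([finsert \<alpha> \<Gamma> \<Rrightarrow> \<Delta>], \<Gamma> \<Rrightarrow> finsert (\<^bold>\<not> \<alpha>) \<Delta>) \<in> kripke_rules"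
| box_right: "([boxes \<Gamma> \<Rrightarrow> finsert \<alpha> (dias \<Delta>)], boxes \<Gamma> \<Rrightarrow> finsert (\<^bold>\<box> \<alpha>) (dias \<Delta>)) \<in> kripke_rules"
| dia_left: "([finsert \<alpha> (boxes \<Gamma>) \<Rrightarrow> dias \<Delta>], finsert (\<^bold>\<diamond> \<alpha>) (boxes \<Gamma>) \<Rrightarrow> dias \<Delta>) \<in> kripke_rules"

definition lTS4 :: calculus where
  "lTS4 = common_rules \<union> twist_rules \<union> local_rules"

definition gTS4 :: calculus where
  "gTS4 = common_rules \<union> twist_rules \<union> global_rules"

definition GS4 :: calculus where
  "GS4 = common_rules \<union> kripke_rules"

definition theorem_equivalent :: "calculus \<Rightarrow> calculus \<Rightarrow> bool" where
  "theorem_equivalent L L' \<longleftrightarrow> (\<forall>S. provable L S \<longleftrightarrow> provable L' S)"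

end

theory Submission
  imports Defs
begin

text \<open>
  All rules of one calculus are derivable in the other. Each of the twist rules is a combination of
  a rule for negation with a rule of Kripke's calculus; for the modal ones, the negated formulas of the
  context are first moved to the other side, which is possible since negation is invertible by cut.
  Conversely, both twist calculi prove \<open>\<alpha> \<Rrightarrow> \<alpha>\<close>,
  \<open>\<alpha>, \<^bold>\<not>\<alpha> \<Rrightarrow>\<close> and \<open>\<Rrightarrow> \<alpha>, \<^bold>\<not>\<alpha>\<close> for every
  formula, whence the rules for negation follow by cut.
\<close>

section \<open>Derivations and rule-by-rule simulation\<close>

lemma provable_rule: "(Ss, S) \<in> L \<Longrightarrow> list_all (provable L) Ss \<Longrightarrow> provable L S"
  by (auto simp: list_all_iff intro: provable.intros)

text \<open>Replacing each inference of a derivation by its simulation reduces the inclusion of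
  calculi to single rules. Initial sequents are covered as rules with an empty list of
  premises.\<close>

lemma provable_if_rules_derivable:
  assumes "\<And>Ss S. (Ss, S) \<in> L \<Longrightarrow> list_all (provable L') Ss \<Longrightarrow> provable L' S"
    and "provable L S"
  shows "provable L' S"
  using assms(2) by induction (auto simp: list_all_iff intro: assms(1))

section \<open>Weakening and general cut from the common rules\<close>

locale common_calculus =
  fixes L :: calculus
  assumes common_rules_subset: "common_rules \<subseteq> L"
begin

abbreviation derives :: "form fset \<Rightarrow> form fset \<Rightarrow> bool"  (infix \<open>\<turnstile>\<close> 55) where
  "\<Gamma> \<turnstile> \<Delta> \<equiv> provable L (\<Gamma> \<Rrightarrow> \<Delta>)"

lemma common_rule: "(Ss, S) \<in> common_rules \<Longrightarrow> list_all (provable L) Ss \<Longrightarrow> provable L S"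
  using common_rules_subset by (blast intro: provable_rule)

lemma conj_left: "finsert \<alpha> (finsert \<beta> \<Gamma>) \<turnstile> \<Delta> \<Longrightarrow> finsert (\<alpha> \<^bold>\<and> \<beta>) \<Gamma> \<turnstile> \<Delta>"
  by (rule common_rule[OF common_rules.conj_left]) simp

lemma conj_right: "\<Gamma> \<turnstile> finsert \<alpha> \<Delta> \<Longrightarrow> \<Gamma> \<turnstile> finsert \<beta> \<Delta> \<Longrightarrow> \<Gamma> \<turnstile> finsert (\<alpha> \<^bold>\<and> \<beta>) \<Delta>"
  by (rule common_rule[OF common_rules.conj_right]) simp

lemma disj_left: "finsert \<alpha> \<Gamma> \<turnstile> \<Delta> \<Longrightarrow> finsert \<beta> \<Gamma> \<turnstile> \<Delta> \<Longrightarrow> finsert (\<alpha> \<^bold>\<or> \<beta>) \<Gamma> \<turnstile> \<Delta>"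
  by (rule common_rule[OF common_rules.disj_left]) simp

lemma disj_right: "\<Gamma> \<turnstile> finsert \<alpha> (finsert \<beta> \<Delta>) \<Longrightarrow> \<Gamma> \<turnstile> finsert (\<alpha> \<^bold>\<or> \<beta>) \<Delta>"
  by (rule common_rule[OF common_rules.disj_right]) simp

lemma imp_left: "\<Gamma> \<turnstile> finsert \<alpha> \<Delta> \<Longrightarrow> finsert \<beta> \<Gamma> \<turnstile> \<Delta> \<Longrightarrow> finsert (\<alpha> \<^bold>\<rightarrow> \<beta>) \<Gamma> \<turnstile> \<Delta>"
  by (rule common_rule[OF common_rules.imp_left]) simp

lemma imp_right: "finsert \<alpha> \<Gamma> \<turnstile> finsert \<beta> \<Delta> \<Longrightarrow> \<Gamma> \<turnstile> finsert (\<alpha> \<^bold>\<rightarrow> \<beta>) \<Delta>"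
  by (rule common_rule[OF common_rules.imp_right]) simp

lemma box_left: "finsert \<alpha> \<Gamma> \<turnstile> \<Delta> \<Longrightarrow> finsert (\<^bold>\<box> \<alpha>) \<Gamma> \<turnstile> \<Delta>"
  by (rule common_rule[OF common_rules.box_left]) simp

lemma dia_right: "\<Gamma> \<turnstile> finsert \<alpha> \<Delta> \<Longrightarrow> \<Gamma> \<turnstile> finsert (\<^bold>\<diamond> \<alpha>) \<Delta>"
  by (rule common_rule[OF common_rules.dia_right]) simp

lemma weaken_union: "\<Gamma> \<turnstile> \<Delta> \<Longrightarrow> \<Gamma>' |\<union>| \<Gamma> \<turnstile> \<Delta>' |\<union>| \<Delta>"
proof (induction \<Gamma>')
  case empty
  then show ?case
    by (induction \<Delta>') (auto intro: common_rule[OF common_rules.we_right])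
qed (auto intro: common_rule[OF common_rules.we_left])

text \<open>A comma is union, so after adding all of the larger sets the original ones are absorbed.
  This form also serves to restore a principal formula in a premise.\<close>

lemma weaken: "\<Gamma> \<turnstile> \<Delta> \<Longrightarrow> \<Gamma> |\<subseteq>| \<Gamma>' \<Longrightarrow> \<Delta> |\<subseteq>| \<Delta>' \<Longrightarrow> \<Gamma>' \<turnstile> \<Delta>'"
  using weaken_union[of \<Gamma> \<Delta> \<Gamma>' \<Delta>'] by (simp add: sup.absorb1)

lemma init_var: "{|Var p|} \<turnstile> {|Var p|}"
  by (rule common_rule[OF common_rules.init]) simp

text \<open>The witness is the disjunction of the succedent.\<close>

lemma succedent_collapse:
  assumes "\<Gamma> \<turnstile> finsert \<alpha> \<Delta>"
  shows "\<exists>\<delta>. \<Gamma> \<turnstile> {|\<delta>|} \<and>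
    (\<forall>\<Theta>. finsert \<alpha> \<Gamma> \<turnstile> \<Theta> \<longrightarrow> (\<forall>\<gamma>. \<gamma> |\<in>| \<Delta> \<longrightarrow> finsert \<gamma> \<Gamma> \<turnstile> \<Theta>) \<longrightarrow> finsert \<delta> \<Gamma> \<turnstile> \<Theta>)"
  using assms
proof (induction \<Delta> arbitrary: \<alpha>)
  case empty
  then show ?case by auto
next
  case (insert \<beta> \<Delta>)
  \<comment> \<open>\<open>disj_right\<close> merges the two leading formulas, and the induction
    hypothesis is applied with their disjunction as the new leading formula; this is why \<alpha> is
    generalized. \<open>disj_left\<close> splits the disjunction again.\<close>
  from insert.IH[OF disj_right[OF insert.prems]] show ?case
    by (blast intro: disj_left)
qed

text \<open>The primitive cut allows no side formulas in the succedent of its left premise.\<close>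

lemma cut_with_side_formulas:
  assumes identity: "\<And>\<gamma>. {|\<gamma>|} \<turnstile> {|\<gamma>|}"
    and left: "\<Gamma> \<turnstile> finsert \<alpha> \<Delta>" and right: "finsert \<alpha> \<Gamma> \<turnstile> \<Delta>"
  shows "\<Gamma> \<turnstile> \<Delta>"
proof -
  obtain \<delta> where \<delta>: "\<Gamma> \<turnstile> {|\<delta>|}"
    and elim: "\<And>\<Theta>. finsert \<alpha> \<Gamma> \<turnstile> \<Theta> \<Longrightarrow> (\<And>\<gamma>. \<gamma> |\<in>| \<Delta> \<Longrightarrow> finsert \<gamma> \<Gamma> \<turnstile> \<Theta>) \<Longrightarrow> finsert \<delta> \<Gamma> \<turnstile> \<Theta>"
    using succedent_collapse[OF left] by blast
  \<comment> \<open>Every disjunct of \<delta> other than \<alpha> is a member of \<Delta> and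
    yields \<Delta> by identity; \<alpha> yields it by the right premise. Identity for arbitrary
    formulas is a hypothesis because the common initial sequents cover only variables.\<close>
  have "finsert \<gamma> \<Gamma> \<turnstile> \<Delta>" if "\<gamma> |\<in>| \<Delta>" for \<gamma>
    using that by (intro weaken[OF identity[of \<gamma>]]) auto
  with elim right have "finsert \<delta> \<Gamma> \<turnstile> \<Delta>" by blast
  with \<delta> show ?thesis
    by (intro common_rule[OF common_rules.cut]) auto
qed

end

section \<open>Kripke's calculus: identity and invertible negation\<close>

interpretation GS4: common_calculus GS4
  by unfold_locales (auto simp: GS4_def)

abbreviation derives_GS4 :: "form fset \<Rightarrow> form fset \<Rightarrow> bool"  (infix \<open>\<turnstile>\<^sub>K\<close> 55) where
  "\<Gamma> \<turnstile>\<^sub>K \<Delta> \<equiv> provable GS4 (\<Gamma> \<Rrightarrow> \<Delta>)"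

lemma kripke_rule: "(Ss, S) \<in> kripke_rules \<Longrightarrow> list_all (provable GS4) Ss \<Longrightarrow> provable GS4 S"
  by (rule provable_rule) (auto simp: GS4_def)

lemma neg_left: "\<Gamma> \<turnstile>\<^sub>K finsert \<alpha> \<Delta> \<Longrightarrow> finsert (\<^bold>\<not> \<alpha>) \<Gamma> \<turnstile>\<^sub>K \<Delta>"
  by (rule kripke_rule[OF kripke_rules.neg_left]) simp

lemma neg_right: "finsert \<alpha> \<Gamma> \<turnstile>\<^sub>K \<Delta> \<Longrightarrow> \<Gamma> \<turnstile>\<^sub>K finsert (\<^bold>\<not> \<alpha>) \<Delta>"
  by (rule kripke_rule[OF kripke_rules.neg_right]) simp

lemma box_right:
  "boxes \<Gamma> \<turnstile>\<^sub>K finsert \<alpha> (dias \<Delta>) \<Longrightarrow> boxes \<Gamma> \<turnstile>\<^sub>K finsert (\<^bold>\<box> \<alpha>) (dias \<Delta>)"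
  by (rule kripke_rule[OF kripke_rules.box_right]) simp

lemma dia_left:
  "finsert \<alpha> (boxes \<Gamma>) \<turnstile>\<^sub>K dias \<Delta> \<Longrightarrow> finsert (\<^bold>\<diamond> \<alpha>) (boxes \<Gamma>) \<turnstile>\<^sub>K dias \<Delta>"
  by (rule kripke_rule[OF kripke_rules.dia_left]) simp

lemma GS4_identity: "{|\<alpha>|} \<turnstile>\<^sub>K {|\<alpha>|}"
proof (induction \<alpha>)
  case (Var p)
  show ?case by (rule GS4.init_var)
next
  case (Conj \<alpha> \<beta>)
  then show ?case
    by (intro GS4.conj_left GS4.conj_right) (auto elim: GS4.weaken)
next
  case (Disj \<alpha> \<beta>)
  then show ?case
    by (intro GS4.disj_right GS4.disj_left) (auto elim: GS4.weaken)
next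
  case (Imp \<alpha> \<beta>)
  \<comment> \<open>\<open>imp_left\<close> comes first, with \<alpha> kept as context. Reordering
    then puts \<alpha> at the head, where \<open>imp_right\<close> discharges it.\<close>
  have "finsert (\<alpha> \<^bold>\<rightarrow> \<beta>) {|\<alpha>|} \<turnstile>\<^sub>K {|\<beta>|}"
    by (intro GS4.imp_left GS4.weaken[OF Imp(1)] GS4.weaken[OF Imp(2)]) auto
  then show ?case by (intro GS4.imp_right) (simp add: finsert_commute)
next
  case (Neg \<alpha>)
  have "finsert (\<^bold>\<not> \<alpha>) {|\<alpha>|} \<turnstile>\<^sub>K {||}"
    using Neg by (rule neg_left)
  then show ?case by (intro neg_right) (simp add: finsert_commute)
next
  case (Box \<alpha>)
  then show ?case
    using box_right[of "{|\<alpha>|}" \<alpha> "{||}"] GS4.box_left by (simp add: boxes_def dias_def)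
next
  case (Dia \<alpha>)
  then show ?case
    using dia_left[of \<alpha> "{||}" "{|\<alpha>|}"] GS4.dia_right by (simp add: boxes_def dias_def)
qed

text \<open>For the inversion, cut on \<open>Neg \<alpha>\<close>: excluded middle supplies the left
  premise and the given sequent, weakened by \<alpha> on the right, the other one. As an equivalence
  the rule can be used for rewriting.\<close>

lemma neg_left_iff: "finsert (\<^bold>\<not> \<alpha>) \<Gamma> \<turnstile>\<^sub>K \<Delta> \<longleftrightarrow> \<Gamma> \<turnstile>\<^sub>K finsert \<alpha> \<Delta>"
proof
  assume *: "finsert (\<^bold>\<not> \<alpha>) \<Gamma> \<turnstile>\<^sub>K \<Delta>"
  have "\<Gamma> \<turnstile>\<^sub>K finsert (\<^bold>\<not> \<alpha>) (finsert \<alpha> \<Delta>)"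
    by (intro neg_right GS4.weaken[OF GS4_identity[of \<alpha>]]) auto
  then show "\<Gamma> \<turnstile>\<^sub>K finsert \<alpha> \<Delta>"
    by (rule GS4.cut_with_side_formulas[OF GS4_identity]) (auto intro: GS4.weaken[OF *])
qed (rule neg_left)

lemma neg_right_iff: "\<Gamma> \<turnstile>\<^sub>K finsert (\<^bold>\<not> \<alpha>) \<Delta> \<longleftrightarrow> finsert \<alpha> \<Gamma> \<turnstile>\<^sub>K \<Delta>"
proof
  assume *: "\<Gamma> \<turnstile>\<^sub>K finsert (\<^bold>\<not> \<alpha>) \<Delta>"
  have "finsert (\<^bold>\<not> \<alpha>) (finsert \<alpha> \<Gamma>) \<turnstile>\<^sub>K \<Delta>"
    by (intro neg_left GS4.weaken[OF GS4_identity[of \<alpha>]]) auto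
  \<comment> \<open>Dually, the contradiction just derived is the right premise of the cut, hence
    \<open>rotated\<close>; the given sequent becomes the left one.\<close>
  then show "finsert \<alpha> \<Gamma> \<turnstile>\<^sub>K \<Delta>"
    by (rule GS4.cut_with_side_formulas[OF GS4_identity, rotated]) (auto intro: GS4.weaken[OF *])
qed (rule neg_right)

lemma negs_left_iff: "\<Gamma> |\<union>| Neg |`| \<Theta> \<turnstile>\<^sub>K \<Delta> \<longleftrightarrow> \<Gamma> \<turnstile>\<^sub>K \<Delta> |\<union>| \<Theta>"
  by (induction \<Theta> arbitrary: \<Delta>) (simp_all add: neg_left_iff)

lemma negs_right_iff: "\<Gamma> \<turnstile>\<^sub>K \<Delta> |\<union>| Neg |`| \<Theta> \<longleftrightarrow> \<Gamma> |\<union>| \<Theta> \<turnstile>\<^sub>K \<Delta>"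
  by (induction \<Theta> arbitrary: \<Gamma>) (simp_all add: neg_right_iff)

lemma negs_iff: "\<Gamma> |\<union>| Neg |`| \<Theta> \<turnstile>\<^sub>K \<Delta> |\<union>| Neg |`| \<Lambda> \<longleftrightarrow> \<Gamma> |\<union>| \<Lambda> \<turnstile>\<^sub>K \<Delta> |\<union>| \<Theta>"
proof -
  \<comment> \<open>After the antecedent has been cleared, \<Theta> stands last in the succedent;
    the negated set has to be last for \<open>negs_right_iff\<close> to match.\<close>
  have "\<Delta> |\<union>| Neg |`| \<Lambda> |\<union>| \<Theta> = \<Delta> |\<union>| \<Theta> |\<union>| Neg |`| \<Lambda>" by auto
  then show ?thesis by (metis negs_left_iff negs_right_iff)
qed

section \<open>Modal contexts and simulation of the twist calculi in \<open>GS4\<close>\<close>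

lemma neg_boxes_eq: "neg_boxes \<Gamma> = Neg |`| boxes \<Gamma>"
  by (simp add: neg_boxes_def boxes_def fset.map_comp comp_def)

lemma neg_dias_eq: "neg_dias \<Gamma> = Neg |`| dias \<Gamma>"
  by (simp add: neg_dias_def dias_def fset.map_comp comp_def)

lemma boxes_union: "boxes \<Gamma> |\<union>| boxes \<Delta> = boxes (\<Gamma> |\<union>| \<Delta>)"
  by (simp add: boxes_def fimage_funion)

lemma dias_union: "dias \<Gamma> |\<union>| dias \<Delta> = dias (\<Gamma> |\<union>| \<Delta>)"
  by (simp add: dias_def fimage_funion)

text \<open>Moving the negated formulas across turns negated diamonds on the left into diamonds on
  the right, and negated boxes on the right into boxes on the left. What remains is exactly a
  context of Kripke's modal rules.\<close>

lemma modal_context_iff: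
  "finsert \<alpha> (boxes \<Gamma>\<^sub>1 |\<union>| neg_dias \<Gamma>\<^sub>2) \<turnstile>\<^sub>K dias \<Delta>\<^sub>1 |\<union>| neg_boxes \<Delta>\<^sub>2 \<longleftrightarrow>
    finsert \<alpha> (boxes (\<Gamma>\<^sub>1 |\<union>| \<Delta>\<^sub>2)) \<turnstile>\<^sub>K dias (\<Delta>\<^sub>1 |\<union>| \<Gamma>\<^sub>2)"
  "boxes \<Gamma>\<^sub>1 |\<union>| neg_dias \<Gamma>\<^sub>2 \<turnstile>\<^sub>K finsert \<alpha> (dias \<Delta>\<^sub>1 |\<union>| neg_boxes \<Delta>\<^sub>2) \<longleftrightarrow>
    boxes (\<Gamma>\<^sub>1 |\<union>| \<Delta>\<^sub>2) \<turnstile>\<^sub>K finsert \<alpha> (dias (\<Delta>\<^sub>1 |\<union>| \<Gamma>\<^sub>2))"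
  \<comment> \<open>The flipped equations push \<alpha> into the first summand and split the merged
    boxes and diamonds, so that both sides of the sequent get the shape of
    \<open>negs_iff\<close>.\<close>
  by (simp_all add: neg_boxes_eq neg_dias_eq negs_iff flip: funion_finsert_left boxes_union dias_union)

text \<open>Moving a negated principal formula to the other side leaves a conclusion of a common
  rule, a premise, or an identity.\<close>

lemma twist_rules_derivable:
  "(Ss, S) \<in> twist_rules \<Longrightarrow> list_all (provable GS4) Ss \<Longrightarrow> provable GS4 S"
proof (induction Ss S rule: twist_rules.induct)
  case (init_neg p)
  \<comment> \<open>Treated separately: moving one of the negations across would put
    \<open>Var p\<close> in front of the other, where the equivalences no longer match.\<close>
  show ?case by (rule GS4_identity)
qed (auto simp: neg_left_iff neg_right_iff GS4_identity
      intro: GS4.conj_left GS4.conj_right GS4.disj_left GS4.disj_right GS4.imp_left GS4.imp_right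
        GS4.box_left GS4.dia_right)

lemma local_rules_derivable:
  "(Ss, S) \<in> local_rules \<Longrightarrow> list_all (provable GS4) Ss \<Longrightarrow> provable GS4 S"
  by (induction Ss S rule: local_rules.induct)
    (auto simp: neg_left_iff neg_right_iff modal_context_iff intro: box_right dia_left)

text \<open>The premises are already in the form that \<open>modal_context_iff\<close> gives to the
  local ones, up to merging unions. In \<open>GS4\<close> both kinds of modal rules are therefore
  the same inference.\<close>

lemma global_rules_derivable:
  "(Ss, S) \<in> global_rules \<Longrightarrow> list_all (provable GS4) Ss \<Longrightarrow> provable GS4 S"
  by (induction Ss S rule: global_rules.induct)
    (auto simp: neg_left_iff neg_right_iff modal_context_iff boxes_union dias_union
      intro: box_right dia_left)

section \<open>Laws of negation in both twist calculi\<close>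

locale twist_calculus =
  fixes L :: calculus
  assumes twist_calculus: "L \<in> {lTS4, gTS4}"

sublocale twist_calculus \<subseteq> common_calculus
  using twist_calculus by unfold_locales (auto simp: lTS4_def gTS4_def)

context twist_calculus
begin

lemma twist_rule: "(Ss, S) \<in> twist_rules \<Longrightarrow> list_all (provable L) Ss \<Longrightarrow> provable L S"
  by (rule provable_rule) (use twist_calculus in \<open>auto simp: lTS4_def gTS4_def\<close>)

text \<open>Allows one argument for both calculi: instances of corresponding rules share their
  conclusion, and once both premises are proved it does not matter which rule is available.\<close>

lemma modal_rule:
  assumes "(Ss, S) \<in> local_rules" "(Ss', S) \<in> global_rules"
    and "list_all (provable L) Ss" "list_all (provable L) Ss'"
  shows "provable L S"
  using assms twist_calculus by (auto simp: lTS4_def gTS4_def intro: provable_rule)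

text \<open>With no negated formulas in the context, the local and the global rule both coincide
  with Kripke's.\<close>

lemma box_right:
  assumes "boxes \<Gamma> \<turnstile> finsert \<alpha> (dias \<Delta>)"
  shows "boxes \<Gamma> \<turnstile> finsert (\<^bold>\<box> \<alpha>) (dias \<Delta>)"
  using modal_rule[OF local_rules.box_right[of \<Gamma> "{||}" \<alpha> \<Delta> "{||}"]
      global_rules.box_right[of \<Gamma> "{||}" \<alpha> \<Delta> "{||}"]] assms
  by (simp add: boxes_def dias_def neg_boxes_def neg_dias_def)

lemma dia_left:
  assumes "finsert \<alpha> (boxes \<Gamma>) \<turnstile> dias \<Delta>"
  shows "finsert (\<^bold>\<diamond> \<alpha>) (boxes \<Gamma>) \<turnstile> dias \<Delta>"
  using modal_rule[OF local_rules.dia_left[of \<alpha> \<Gamma> "{||}" \<Delta> "{||}"]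
      global_rules.dia_left[of \<alpha> \<Gamma> "{||}" \<Delta> "{||}"]] assms
  by (simp add: boxes_def dias_def neg_boxes_def neg_dias_def)

lemma neg_box_right: "finsert \<alpha> \<Gamma> \<turnstile> \<Delta> \<Longrightarrow> \<Gamma> \<turnstile> finsert (\<^bold>\<not> \<^bold>\<box> \<alpha>) \<Delta>"
  by (rule twist_rule[OF twist_rules.neg_box_right]) simp

lemma neg_dia_left: "\<Gamma> \<turnstile> finsert \<alpha> \<Delta> \<Longrightarrow> finsert (\<^bold>\<not> \<^bold>\<diamond> \<alpha>) \<Gamma> \<turnstile> \<Delta>"
  by (rule twist_rule[OF twist_rules.neg_dia_left]) simp

lemma box_axioms:
  assumes "{|\<alpha>|} \<turnstile> {|\<alpha>|}"
  shows "{|\<^bold>\<box> \<alpha>|} \<turnstile> {|\<^bold>\<box> \<alpha>|}" "{|\<^bold>\<not> \<^bold>\<box> \<alpha>|} \<turnstile> {|\<^bold>\<not> \<^bold>\<box> \<alpha>|}"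
    "{|\<^bold>\<not> \<^bold>\<box> \<alpha>, \<^bold>\<box> \<alpha>|} \<turnstile> {||}" "{||} \<turnstile> {|\<^bold>\<box> \<alpha>, \<^bold>\<not> \<^bold>\<box> \<alpha>|}"
proof -
  note defs = boxes_def dias_def neg_boxes_def neg_dias_def
  have 1: "{|\<^bold>\<box> \<alpha>|} \<turnstile> {|\<alpha>|}" using assms by (rule box_left)
  have 2: "{||} \<turnstile> {|\<alpha>, \<^bold>\<not> \<^bold>\<box> \<alpha>|}"
    using neg_box_right[OF assms] by (simp add: finsert_commute)
  show "{|\<^bold>\<box> \<alpha>|} \<turnstile> {|\<^bold>\<box> \<alpha>|}"
    using box_right[of "{|\<alpha>|}" \<alpha> "{||}"] 1 by (simp add: defs)
  show "{|\<^bold>\<not> \<^bold>\<box> \<alpha>|} \<turnstile> {|\<^bold>\<not> \<^bold>\<box> \<alpha>|}"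
    \<comment> \<open>In both instances \<open>{|\<alpha>|}\<close> is the set of negated boxes in
      the succedent; its position differs because variables are numbered by occurrence. The local
      premise keeps the negated box and is fact 2, the global one has the box on the left and is
      fact 1.\<close>
    using modal_rule[OF local_rules.neg_box_left[of "{||}" "{||}" \<alpha> "{||}" "{|\<alpha>|}"]
        global_rules.neg_box_left[of "{||}" "{|\<alpha>|}" \<alpha> "{||}" "{||}"]] 1 2 by (simp add: defs)
  show "{|\<^bold>\<not> \<^bold>\<box> \<alpha>, \<^bold>\<box> \<alpha>|} \<turnstile> {||}"
    using modal_rule[OF local_rules.neg_box_left[of "{|\<alpha>|}" "{||}" \<alpha> "{||}" "{||}"]
        global_rules.neg_box_left[of "{|\<alpha>|}" "{||}" \<alpha> "{||}" "{||}"]] 1 by (simp add: defs)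
  show "{||} \<turnstile> {|\<^bold>\<box> \<alpha>, \<^bold>\<not> \<^bold>\<box> \<alpha>|}"
    using modal_rule[OF local_rules.box_right[of "{||}" "{||}" \<alpha> "{||}" "{|\<alpha>|}"]
        global_rules.box_right[of "{||}" "{|\<alpha>|}" \<alpha> "{||}" "{||}"]] 1 2 by (simp add: defs)
qed

lemma dia_axioms:
  assumes "{|\<alpha>|} \<turnstile> {|\<alpha>|}"
  shows "{|\<^bold>\<diamond> \<alpha>|} \<turnstile> {|\<^bold>\<diamond> \<alpha>|}" "{|\<^bold>\<not> \<^bold>\<diamond> \<alpha>|} \<turnstile> {|\<^bold>\<not> \<^bold>\<diamond> \<alpha>|}"
    "{|\<^bold>\<diamond> \<alpha>, \<^bold>\<not> \<^bold>\<diamond> \<alpha>|} \<turnstile> {||}" "{||} \<turnstile> {|\<^bold>\<not> \<^bold>\<diamond> \<alpha>, \<^bold>\<diamond> \<alpha>|}"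
proof -
  note defs = boxes_def dias_def neg_boxes_def neg_dias_def
  have 1: "{|\<alpha>|} \<turnstile> {|\<^bold>\<diamond> \<alpha>|}" using assms by (rule dia_right)
  have 2: "{|\<alpha>, \<^bold>\<not> \<^bold>\<diamond> \<alpha>|} \<turnstile> {||}"
    using neg_dia_left[OF assms] by (simp add: finsert_commute)
  show "{|\<^bold>\<diamond> \<alpha>|} \<turnstile> {|\<^bold>\<diamond> \<alpha>|}"
    using dia_left[of \<alpha> "{||}" "{|\<alpha>|}"] 1 by (simp add: defs)
  show "{|\<^bold>\<not> \<^bold>\<diamond> \<alpha>|} \<turnstile> {|\<^bold>\<not> \<^bold>\<diamond> \<alpha>|}"
    \<comment> \<open>Here \<open>{|\<alpha>|}\<close> is the set of negated diamonds in the
      antecedent: the local premise is fact 2, the global one fact 1.\<close>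
    using modal_rule[OF local_rules.neg_dia_right[of \<alpha> "{||}" "{|\<alpha>|}" "{||}" "{||}"]
        global_rules.neg_dia_right[of \<alpha> "{||}" "{||}" "{||}" "{|\<alpha>|}"]] 1 2 by (simp add: defs)
  show "{|\<^bold>\<diamond> \<alpha>, \<^bold>\<not> \<^bold>\<diamond> \<alpha>|} \<turnstile> {||}"
    using modal_rule[OF local_rules.dia_left[of \<alpha> "{||}" "{|\<alpha>|}" "{||}" "{||}"]
        global_rules.dia_left[of \<alpha> "{||}" "{||}" "{||}" "{|\<alpha>|}"]] 1 2 by (simp add: defs)
  show "{||} \<turnstile> {|\<^bold>\<not> \<^bold>\<diamond> \<alpha>, \<^bold>\<diamond> \<alpha>|}"
    using modal_rule[OF local_rules.neg_dia_right[of \<alpha> "{||}" "{||}" "{|\<alpha>|}" "{||}"]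
        global_rules.neg_dia_right[of \<alpha> "{||}" "{||}" "{|\<alpha>|}" "{||}"]] 1 by (simp add: defs)
qed

text \<open>The four claims are proved together for the sake of the case \<open>Neg\<close>.
  Identity for \<open>Neg \<alpha>\<close> is the second claim for \<alpha>, and the rules for
  double negation obtain the other three from the remaining claims for \<alpha>.\<close>

lemma twist_axioms:
  "{|\<alpha>|} \<turnstile> {|\<alpha>|} \<and> {|\<^bold>\<not> \<alpha>|} \<turnstile> {|\<^bold>\<not> \<alpha>|} \<and>
    {|\<alpha>, \<^bold>\<not> \<alpha>|} \<turnstile> {||} \<and> {||} \<turnstile> {|\<alpha>, \<^bold>\<not> \<alpha>|}"
proof (induction \<alpha>)
  case (Var p)
  have "{|\<^bold>\<not> Var p|} \<turnstile> {|\<^bold>\<not> Var p|}" "{|\<^bold>\<not> Var p, Var p|} \<turnstile> {||}" "{||} \<turnstile> {|\<^bold>\<not> Var p, Var p|}"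
    by (auto intro: twist_rule twist_rules.intros)
  then show ?case by (simp add: init_var finsert_commute)
next
  case (Conj \<alpha> \<beta>)
  then have \<alpha>: "{|\<alpha>|} \<turnstile> {|\<alpha>|}" and \<beta>: "{|\<beta>|} \<turnstile> {|\<beta>|}" by auto
  have left: "finsert (\<^bold>\<not> (\<alpha> \<^bold>\<and> \<beta>)) \<Gamma> \<turnstile> \<Delta>"
    if "\<Gamma> \<turnstile> finsert \<alpha> \<Delta>" "\<Gamma> \<turnstile> finsert \<beta> \<Delta>" for \<Gamma> \<Delta>
    using that by (intro twist_rule[OF twist_rules.neg_conj_left]) simp
  have right: "\<Gamma> \<turnstile> finsert (\<^bold>\<not> (\<alpha> \<^bold>\<and> \<beta>)) \<Delta>" if "finsert \<alpha> (finsert \<beta> \<Gamma>) \<turnstile> \<Delta>" for \<Gamma> \<Delta>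
    using that by (intro twist_rule[OF twist_rules.neg_conj_right]) simp
  \<comment> \<open>All four claims for the conjunction reduce to these two projections. The
    disjunction is handled dually with the two injections.\<close>
  have \<alpha>': "{|\<alpha>, \<beta>|} \<turnstile> {|\<alpha>|}" and \<beta>': "{|\<alpha>, \<beta>|} \<turnstile> {|\<beta>|}"
    by (auto intro: weaken[OF \<alpha>] weaken[OF \<beta>])
  have "{|\<alpha> \<^bold>\<and> \<beta>|} \<turnstile> {|\<alpha> \<^bold>\<and> \<beta>|}"
    using \<alpha>' \<beta>' by (intro conj_left conj_right)
  moreover have "{|\<^bold>\<not> (\<alpha> \<^bold>\<and> \<beta>)|} \<turnstile> {|\<^bold>\<not> (\<alpha> \<^bold>\<and> \<beta>)|}"
    using left[OF \<alpha>' \<beta>'] by (intro right) (simp add: finsert_commute)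
  moreover have "{|\<alpha> \<^bold>\<and> \<beta>, \<^bold>\<not> (\<alpha> \<^bold>\<and> \<beta>)|} \<turnstile> {||}"
    using left[OF \<alpha>' \<beta>'] by (intro conj_left) (simp add: finsert_commute)
  moreover have "{||} \<turnstile> {|\<alpha> \<^bold>\<and> \<beta>, \<^bold>\<not> (\<alpha> \<^bold>\<and> \<beta>)|}"
    using right[OF \<alpha>'] right[OF \<beta>'] by (intro conj_right) (simp_all add: finsert_commute)
  ultimately show ?case by blast
next
  case (Disj \<alpha> \<beta>)
  then have \<alpha>: "{|\<alpha>|} \<turnstile> {|\<alpha>|}" and \<beta>: "{|\<beta>|} \<turnstile> {|\<beta>|}" by auto
  have left: "finsert (\<^bold>\<not> (\<alpha> \<^bold>\<or> \<beta>)) \<Gamma> \<turnstile> \<Delta>" if "\<Gamma> \<turnstile> finsert \<alpha> (finsert \<beta> \<Delta>)" for \<Gamma> \<Delta>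
    using that by (intro twist_rule[OF twist_rules.neg_disj_left]) simp
  have right: "\<Gamma> \<turnstile> finsert (\<^bold>\<not> (\<alpha> \<^bold>\<or> \<beta>)) \<Delta>"
    if "finsert \<alpha> \<Gamma> \<turnstile> \<Delta>" "finsert \<beta> \<Gamma> \<turnstile> \<Delta>" for \<Gamma> \<Delta>
    using that by (intro twist_rule[OF twist_rules.neg_disj_right]) simp
  have \<alpha>': "{|\<alpha>|} \<turnstile> {|\<alpha>, \<beta>|}" and \<beta>': "{|\<beta>|} \<turnstile> {|\<alpha>, \<beta>|}"
    by (auto intro: weaken[OF \<alpha>] weaken[OF \<beta>])
  have "{|\<alpha> \<^bold>\<or> \<beta>|} \<turnstile> {|\<alpha> \<^bold>\<or> \<beta>|}"
    using \<alpha>' \<beta>' by (intro disj_right disj_left)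
  moreover have "{|\<^bold>\<not> (\<alpha> \<^bold>\<or> \<beta>)|} \<turnstile> {|\<^bold>\<not> (\<alpha> \<^bold>\<or> \<beta>)|}"
    using right[OF \<alpha>' \<beta>'] by (intro left) (simp add: finsert_commute)
  moreover have "{|\<alpha> \<^bold>\<or> \<beta>, \<^bold>\<not> (\<alpha> \<^bold>\<or> \<beta>)|} \<turnstile> {||}"
    using left[OF \<alpha>'] left[OF \<beta>'] by (intro disj_left) (simp_all add: finsert_commute)
  moreover have "{||} \<turnstile> {|\<alpha> \<^bold>\<or> \<beta>, \<^bold>\<not> (\<alpha> \<^bold>\<or> \<beta>)|}"
    using right[OF \<alpha>' \<beta>'] by (intro disj_right) (simp add: finsert_commute)
  ultimately show ?case by blast
next
  case (Imp \<alpha> \<beta>)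
  then have \<alpha>: "{|\<alpha>|} \<turnstile> {|\<alpha>|}" and \<beta>: "{|\<beta>|} \<turnstile> {|\<beta>|}" by auto
  have left: "finsert (\<^bold>\<not> (\<alpha> \<^bold>\<rightarrow> \<beta>)) \<Gamma> \<turnstile> \<Delta>" if "finsert \<alpha> \<Gamma> \<turnstile> finsert \<beta> \<Delta>" for \<Gamma> \<Delta>
    using that by (intro twist_rule[OF twist_rules.neg_imp_left]) simp
  have right: "\<Gamma> \<turnstile> finsert (\<^bold>\<not> (\<alpha> \<^bold>\<rightarrow> \<beta>)) \<Delta>"
    if "\<Gamma> \<turnstile> finsert \<alpha> \<Delta>" "finsert \<beta> \<Gamma> \<turnstile> \<Delta>" for \<Gamma> \<Delta>
    using that by (intro twist_rule[OF twist_rules.neg_imp_right]) simp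
  have \<alpha>': "{|\<alpha>|} \<turnstile> {|\<alpha>, \<beta>|}" and \<beta>': "{|\<beta>, \<alpha>|} \<turnstile> {|\<beta>|}"
    by (auto intro: weaken[OF \<alpha>] weaken[OF \<beta>])
  \<comment> \<open>Modus ponens and its twist with the negated implication on the right. Each gives
    two of the claims, by discharging \<alpha> and \<beta> once with \<open>imp_right\<close> and
    once with \<open>left\<close>.\<close>
  have *: "{|\<alpha>, \<alpha> \<^bold>\<rightarrow> \<beta>|} \<turnstile> {|\<beta>|}"
    using imp_left[OF \<alpha>' \<beta>'] by (simp add: finsert_commute)
  have **: "{|\<alpha>|} \<turnstile> {|\<beta>, \<^bold>\<not> (\<alpha> \<^bold>\<rightarrow> \<beta>)|}"
    using right[OF \<alpha>' \<beta>'] by (simp add: finsert_commute)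
  have "{|\<alpha> \<^bold>\<rightarrow> \<beta>|} \<turnstile> {|\<alpha> \<^bold>\<rightarrow> \<beta>|}" using * by (rule imp_right)
  moreover have "{|\<^bold>\<not> (\<alpha> \<^bold>\<rightarrow> \<beta>)|} \<turnstile> {|\<^bold>\<not> (\<alpha> \<^bold>\<rightarrow> \<beta>)|}" using ** by (rule left)
  moreover have "{|\<alpha> \<^bold>\<rightarrow> \<beta>, \<^bold>\<not> (\<alpha> \<^bold>\<rightarrow> \<beta>)|} \<turnstile> {||}"
    using left[OF *] by (simp add: finsert_commute)
  moreover have "{||} \<turnstile> {|\<alpha> \<^bold>\<rightarrow> \<beta>, \<^bold>\<not> (\<alpha> \<^bold>\<rightarrow> \<beta>)|}" using ** by (rule imp_right)
  ultimately show ?case by blast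
next
  case (Neg \<alpha>)
  have left: "finsert (\<^bold>\<not> \<^bold>\<not> \<alpha>) \<Gamma> \<turnstile> \<Delta>" if "finsert \<alpha> \<Gamma> \<turnstile> \<Delta>" for \<Gamma> \<Delta>
    using that by (intro twist_rule[OF twist_rules.neg_neg_left]) simp
  have right: "\<Gamma> \<turnstile> finsert (\<^bold>\<not> \<^bold>\<not> \<alpha>) \<Delta>" if "\<Gamma> \<turnstile> finsert \<alpha> \<Delta>" for \<Gamma> \<Delta>
    using that by (intro twist_rule[OF twist_rules.neg_neg_right]) simp
  from Neg show ?case
    using left[of "{|\<^bold>\<not> \<alpha>|}" "{||}"] right[of "{||}" "{|\<^bold>\<not> \<alpha>|}"]
    by (auto simp: finsert_commute intro: left right)
next
  case (Box \<alpha>)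
  then show ?case using box_axioms[of \<alpha>] by (simp add: finsert_commute)
next
  case (Dia \<alpha>)
  then show ?case using dia_axioms[of \<alpha>] by (simp add: finsert_commute)
qed

lemma identity: "{|\<alpha>|} \<turnstile> {|\<alpha>|}"
  and contradiction: "{|\<alpha>, \<^bold>\<not> \<alpha>|} \<turnstile> {||}"
  and excluded_middle: "{||} \<turnstile> {|\<alpha>, \<^bold>\<not> \<alpha>|}"
  using twist_axioms by blast+

text \<open>Cut on \<alpha> against the contradiction of \<alpha> and \<open>Neg \<alpha>\<close>.
  Since \<Delta> accompanies \<alpha> in the left premise, the general form of cut is called
  for.\<close>

lemma neg_left:
  assumes "\<Gamma> \<turnstile> finsert \<alpha> \<Delta>"
  shows "finsert (\<^bold>\<not> \<alpha>) \<Gamma> \<turnstile> \<Delta>"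
  by (rule cut_with_side_formulas[of _ \<alpha>])
    (auto intro: identity weaken[OF assms] weaken[OF contradiction[of \<alpha>]])

lemma neg_right:
  assumes "finsert \<alpha> \<Gamma> \<turnstile> \<Delta>"
  shows "\<Gamma> \<turnstile> finsert (\<^bold>\<not> \<alpha>) \<Delta>"
  by (rule cut_with_side_formulas[of _ \<alpha>])
    (auto intro: identity weaken[OF assms] weaken[OF excluded_middle[of \<alpha>]])

lemma kripke_rules_derivable:
  "(Ss, S) \<in> kripke_rules \<Longrightarrow> list_all (provable L) Ss \<Longrightarrow> provable L S"
  by (induction Ss S rule: kripke_rules.induct)
    (auto intro: neg_left neg_right box_right dia_left)

end

theorem theorem3p3:
  fixes L :: calculus
  assumes "L \<in> {lTS4, gTS4}"
  shows "theorem_equivalent L GS4"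
proof -
  interpret twist_calculus L using assms by unfold_locales
  have "provable GS4 S" if "(Ss, S) \<in> L" "list_all (provable GS4) Ss" for Ss S
    using that assms
    by (auto simp: lTS4_def gTS4_def intro: GS4.common_rule twist_rules_derivable
        local_rules_derivable global_rules_derivable)
  moreover have "provable L S" if "(Ss, S) \<in> GS4" "list_all (provable L) Ss" for Ss S
    using that by (auto simp: GS4_def intro: common_rule kripke_rules_derivable)
  ultimately show ?thesis
    unfolding theorem_equivalent_def by (blast intro: provable_if_rules_derivable)
qed

end
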